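(* Let $n\ge 2$, let $(I_k)_{0\le k\le n}$ be intervals of $\mathbb{R}$, and let $(g_k)_{1\le k\le n}$ be differentiable functions with $g_k: I_k\to I_{k-1}$. For $1\le i\le n$ let $G_i = g_{i+1}\circ g_{i+2}\circ\cdots\circ g_n$, with $G_n=\mathrm{id}$. Then $$\left(g_1\circ g_2\circ\cdots\circ g_n\right)' \;=\; g_n'\times\prod_{i=1}^{n-1}\left[g_i'\circ G_i\right] \;=\; \prod_{i=1}^{n}\left[g_i'\circ G_i\right].$$
   Context: Products denote pointwise products of real-valued functions on $I_n$, and $\mathrm{id}$ is the identity function of $I_n$. By convention, an empty composition is the identity and an empty product is $1$. *)

theory Defs
  imports "HOL-Analysis.Analysis"
begin

text \<open>The functions are total in HOL, but only their values on the given interval may matter,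
  also at endpoints belonging to the interval. Hence the derivative is taken within the set
  (one-sided at endpoints) rather than with \<^const>\<open>deriv\<close>. It is determined
  uniquely at every limit point of \<open>S\<close> lying in \<open>S\<close>.\<close>

definition derivative_on :: "real set \<Rightarrow> (real \<Rightarrow> real) \<Rightarrow> real \<Rightarrow> real" where
  "derivative_on S f = (\<lambda>x. vector_derivative f (at x within S))"

text \<open>\<open>comps g i j\<close> is \<open>g i \<circ> g (i + 1) \<circ> \<dots> \<circ> g j\<close>, and the identity if \<open>j < i\<close>.\<close>

definition comps :: "(nat \<Rightarrow> 'a \<Rightarrow> 'a) \<Rightarrow> nat \<Rightarrow> nat \<Rightarrow> 'a \<Rightarrow> 'a" where
  "comps g i j = foldr (\<circ>) (map g [i..<Suc j]) id"

lemma comps_empty: "j < i \<Longrightarrow> comps g i j = id"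
  by (simp add: comps_def)

lemma comps_rec: "i \<le> j \<Longrightarrow> comps g i j = g i \<circ> comps g (Suc i) j"
  by (simp add: comps_def upt_conv_Cons del: upt_Suc)

end

theory Submission
  imports Defs
begin

text \<open>
  The chain rule for derivatives within sets, iterated from the innermost function outwards, shows
  that \<open>g\<^sub>i \<circ> \<dots> \<circ> g\<^sub>n\<close> has at \<open>x\<close> within \<open>I\<^sub>n\<close> the derivative
  \<open>\<Prod>\<^sub>j g\<^sub>j'(G\<^sub>j x)\<close> (\<open>comps_has_field_derivative\<close>).

  An intermediate interval \<open>I\<^sub>k\<close> may be a single point, where every number is a derivative of
  \<open>g\<^sub>k\<close> and \<^const>\<open>derivative_on\<close> is an arbitrary choice. This does no harm: the chain rule only
  needs \<^const>\<open>derivative_on\<close> to be \<^emph>\<open>a\<close> derivative of each \<open>g\<^sub>k\<close>. Uniqueness of the derivative is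
  used once, for the whole composition on \<open>I\<^sub>n\<close>. It holds there because an interval with two
  distinct points has no isolated points.
\<close>

lemma differentiable_on_imp_has_field_derivative:
  assumes "f differentiable_on S" "x \<in> S"
  shows "(f has_field_derivative derivative_on S f x) (at x within S)"
  using assms vector_derivative_works[of f "at x within S"]
  by (simp add: differentiable_on_def derivative_on_def has_real_derivative_iff_has_vector_derivative)

lemma derivative_on_eqI:
  assumes "is_interval S" "x \<in> S" "\<exists>a\<in>S. \<exists>b\<in>S. a \<noteq> b"
    and "(f has_field_derivative D) (at x within S)"
  shows "derivative_on S f x = D"
proof -
  have "x islimpt S"
    using assms(1-3) by (intro connected_imp_perfect) (auto simp: is_interval_connected)
  then have "at x within S \<noteq> bot"
    by (simp add: trivial_limit_within)
  then show ?thesis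
    using assms(4)
    by (simp add: derivative_on_def vector_derivative_within
        has_real_derivative_iff_has_vector_derivative)
qed

lemma comps_mapsto:
  assumes "\<And>k. 1 \<le> k \<Longrightarrow> k \<le> n \<Longrightarrow> g k \<in> I k \<rightarrow> I (k - 1)"
    and "1 \<le> i" "i \<le> Suc n"
  shows "comps g i n \<in> I n \<rightarrow> I (i - 1)"
  using assms(3,2)
proof (induction i rule: inc_induct)
  case base
  show ?case by (simp add: comps_empty)
next
  case (step i)
  then show ?case
    using assms(1)[of i] by (auto simp: comps_rec Pi_iff)
qed

lemma comps_has_field_derivative:
  fixes g d :: "nat \<Rightarrow> 'a::real_normed_field \<Rightarrow> 'a"
  assumes maps: "\<And>k. 1 \<le> k \<Longrightarrow> k \<le> n \<Longrightarrow> g k \<in> I k \<rightarrow> I (k - 1)"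
    and deriv: "\<And>k y. 1 \<le> k \<Longrightarrow> k \<le> n \<Longrightarrow> y \<in> I k \<Longrightarrow>
      (g k has_field_derivative d k y) (at y within I k)"
    and "x \<in> I n" "1 \<le> i" "i \<le> Suc n"
  shows "(comps g i n has_field_derivative (\<Prod>j=i..n. d j (comps g (Suc j) n x)))
    (at x within I n)"
  using assms(5,4)
proof (induction i rule: inc_induct)
  case base
  show ?case by (simp add: comps_empty id_def)
next
  case (step i)
  let ?h = "comps g (Suc i) n"
  have h: "?h \<in> I n \<rightarrow> I i"
    using comps_mapsto[of n g I "Suc i"] maps step.hyps by simp
  have "(g i has_field_derivative d i (?h x)) (at (?h x) within ?h ` I n)"
    using h \<open>x \<in> I n\<close> step.prems step.hyps
    by (intro has_field_derivative_subset[OF deriv]) auto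
  then have "(g i \<circ> ?h has_field_derivative
      d i (?h x) * (\<Prod>j=Suc i..n. d j (comps g (Suc j) n x))) (at x within I n)"
    using step.IH by (intro DERIV_image_chain) auto
  then show ?case
    using step.hyps by (simp add: comps_rec prod.atLeast_Suc_atMost o_def)
qed

theorem lemma2p4p1:
  fixes n :: nat
    and I :: "nat \<Rightarrow> real set"
    and g :: "nat \<Rightarrow> real \<Rightarrow> real"
    and G :: "nat \<Rightarrow> real \<Rightarrow> real"
  assumes "n \<ge> 2"
    and "\<And>k. k \<le> n \<Longrightarrow> is_interval (I k)"
    and "\<exists>a\<in>I n. \<exists>b\<in>I n. a \<noteq> b"
    and "\<And>k. 1 \<le> k \<Longrightarrow> k \<le> n \<Longrightarrow> g k \<in> I k \<rightarrow> I (k - 1)"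
    and "\<And>k. 1 \<le> k \<Longrightarrow> k \<le> n \<Longrightarrow> g k differentiable_on I k"
    and "\<And>i. 1 \<le> i \<Longrightarrow> i \<le> n \<Longrightarrow> G i = comps g (i + 1) n"
  shows "comps g 1 n differentiable_on I n \<and>
    (\<forall>x\<in>I n.
      derivative_on (I n) (comps g 1 n) x =
        derivative_on (I n) (g n) x * (\<Prod>i=1..n-1. (derivative_on (I i) (g i) \<circ> G i) x) \<and>
      derivative_on (I n) (g n) x * (\<Prod>i=1..n-1. (derivative_on (I i) (g i) \<circ> G i) x) =
        (\<Prod>i=1..n. (derivative_on (I i) (g i) \<circ> G i) x))"
proof -
  let ?d = "\<lambda>k. derivative_on (I k) (g k)"
  have G: "G i x = comps g (Suc i) n x" if "i \<in> {1..n}" for i x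
    using that assms(6)[of i] by simp
  have comps: "(comps g 1 n has_field_derivative (\<Prod>i=1..n. (?d i \<circ> G i) x)) (at x within I n)"
    if "x \<in> I n" for x
  proof -
    have "(comps g 1 n has_field_derivative (\<Prod>i=1..n. ?d i (comps g (Suc i) n x)))
        (at x within I n)"
      using that assms(4,5)
      by (intro comps_has_field_derivative differentiable_on_imp_has_field_derivative) auto
    then show ?thesis
      by (simp add: G)
  qed
  have last: "?d n x * (\<Prod>i=1..n-1. (?d i \<circ> G i) x) = (\<Prod>i=1..n. (?d i \<circ> G i) x)" for x
  proof -
    have "G n x = x"
      using assms(1) by (simp add: G comps_empty)
    moreover have "{1..n} = insert n {1..n-1}" "n \<notin> {1..n-1}"
      using assms(1) by auto
    ultimately show ?thesis
      by simp
  qed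
  have "comps g 1 n differentiable_on I n"
    using comps unfolding differentiable_on_def has_field_derivative_def differentiable_def
    by (intro ballI exI)
  moreover have "derivative_on (I n) (comps g 1 n) x = (\<Prod>i=1..n. (?d i \<circ> G i) x)"
    if "x \<in> I n" for x
    using assms(2)[of n] assms(3) that comps[OF that] by (intro derivative_on_eqI) auto
  ultimately show ?thesis
    using last by simp
qed

end
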